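(* Let $g$ be a concave distortion function satisfying (A1) and (A2), and let $\mu\in\mathbb R$, $\sigma>0$ and $\varepsilon$ satisfy (A3). Put $c_0=\operatorname{corr}(F^{-1}(U),\gamma(U))$, $V=\operatorname{var}(\gamma(U))$, $C_{\gamma,F}=\operatorname{cov}(F^{-1}(U),\gamma(U))$ and $$K=\tfrac12\big(\mu_F^2+\sigma_F^2+\mu^2+\sigma^2-2\mu\mu_F-\varepsilon\big).$$ For $\lambda\ge 0$ define $$h_\lambda(u)=\mu+\sigma\,\frac{\gamma(u)+\lambda F^{-1}(u)-a_\lambda}{b_\lambda},\qquad 0<u<1,$$ where $a_\lambda=\mathbb E(\gamma(U)+\lambda F^{-1}(U))$ and $b_\lambda=\operatorname{std}(\gamma(U)+\lambda F^{-1}(U))$. 1. Suppose $c_0<1$ and $(\mu_F-\mu)^2+(\sigma_F-\sigma)^2<\varepsilon<(\mu_F-\mu)^2+(\sigma_F-\sigma)^2+2\sigma\sigma_F(1-c_0)$. Then $K\ge 0$, and the equation $d_W(F^{-1},h_\lambda)=\sqrt\varepsilon$ has a unique positive solution $\lambda$, namely $$\lambda=\frac{K}{\sigma_F^2}\sqrt{\frac{C_{\gamma,F}^2-V\sigma_F^2}{K^2-\sigma^2\sigma_F^2}}-\frac{C_{\gamma,F}}{\sigma_F^2}.$$ For this $\lambda$, the problem $\sup_{G\in\mathcal M_\varepsilon(\mu,\sigma)}H_g(G)$ has a unique maximiser, whose quantile function is $h_\lambda$. The supremum equals $$H_g(h_\lambda)=\mu+\frac{\sigma}{b_\lambda}\big(V+\lambda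 C_{\gamma,F}\big)=\mu+\sigma\operatorname{std}(\gamma(U))\operatorname{corr}\big(\gamma(U),\gamma(U)+\lambda F^{-1}(U)\big),$$ and it is a continuous function of $\varepsilon$. 2. Suppose $\varepsilon\ge(\mu_F-\mu)^2+(\sigma_F-\sigma)^2+2\sigma\sigma_F(1-c_0)$ (this includes $\varepsilon=+\infty$). Then the unique maximiser has quantile function $h_0$, and the supremum equals $\mu+\sigma\operatorname{std}(\gamma(U))$.
   Context: Let $(\Omega,\mathcal A,\mathbb P)$ be an atomless probability space and $U\sim\mathcal U(0,1)$. $\mathcal M^2$ denotes the set of distribution functions on $\mathbb R$ with finite second moment. For $G\in\mathcal M^2$, $G^{-1}(u)=\inf\{y:G(y)\ge u\}$ is its left-continuous quantile function. A distortion function is a non-decreasing $g:[0,1]\to[0,1]$ with $g(0)=0$, $g(1)=1$. For absolutely continuous $g$ let $\gamma(u)=\partial_-g(x)|_{x=1-u}$ (left derivative), $0<u<1$; then $\int_0^1\gamma=1$. The distortion risk measure is $H_g(G)=\int_0^1\gamma(u)G^{-1}(u)\,du$, also written $H_g(G^{-1})$. Standing assumptions: - (A1) $g$ is absolutely continuous and $\int_0^1\gamma(u)^2du<\infty$; - (A2) $\gamma$ is not (a.e.) identically $1$. The order-2 Wasserstein distance is $d_W(G_1,G_2)=\big(\int_0^1(G_1^{-1}(u)-G_2^{-1}(u))^2du\big)^{1/2}$. A reference distribution $F\in\mathcal M^2$ is fixed, with mean $\mu_F$ and standard deviation $\sigma_F>0$. For $\mu\in\mathbb R$, $\sigma>0$,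 $0\le\varepsilon\le\infty$: $$\mathcal M_\varepsilon(\mu,\sigma)=\Big\{G\in\mathcal M^2:\int x\,dG=\mu,\ \int x^2dG=\mu^2+\sigma^2,\ d_W(F,G)\le\sqrt\varepsilon\Big\},$$ and $\mathcal M(\mu,\sigma)=\mathcal M_\infty(\mu,\sigma)$. - (A3) $\varepsilon>(\mu_F-\mu)^2+(\sigma_F-\sigma)^2$. Uniqueness of an optimiser refers to its quantile function. *)

theory Defs
  imports "HOL-Probability.Probability"
begin

definition abs_cont_on :: "real set \<Rightarrow> (real \<Rightarrow> real) \<Rightarrow> bool" where
  "abs_cont_on S g \<longleftrightarrow>
    (\<forall>e>0. \<exists>d>0. \<forall>(n::nat) (a::nat\<Rightarrow>real) b.
       (\<forall>i<n. a i \<in> S \<and> b i \<in> S \<and> a i \<le> b i) \<and>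
       (\<forall>i<n. \<forall>j<n. i \<noteq> j \<longrightarrow> b i \<le> a j \<or> b j \<le> a i) \<and>
       (\<Sum>i<n. b i - a i) < d
       \<longrightarrow> (\<Sum>i<n. \<bar>g (b i) - g (a i)\<bar>) < e)"

definition distortion :: "(real \<Rightarrow> real) \<Rightarrow> bool" where
  "distortion g \<longleftrightarrow> mono_on {0..1} g \<and> g ` {0..1} \<subseteq> {0..1} \<and> g 0 = 0 \<and> g 1 = 1"

definition left_deriv :: "(real \<Rightarrow> real) \<Rightarrow> real \<Rightarrow> real" where
  "left_deriv g x = Lim (at_left x) (\<lambda>y. (g x - g y) / (x - y))"

definition gam :: "(real \<Rightarrow> real) \<Rightarrow> real \<Rightarrow> real" where
  "gam g u = left_deriv g (1 - u)"

definition EU :: "(real \<Rightarrow> real) \<Rightarrow> real" where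
  "EU f = (\<integral>u\<in>{0<..<1}. f u \<partial>lborel)"

definition covU :: "(real \<Rightarrow> real) \<Rightarrow> (real \<Rightarrow> real) \<Rightarrow> real" where
  "covU f h = EU (\<lambda>u. f u * h u) - EU f * EU h"

definition varU :: "(real \<Rightarrow> real) \<Rightarrow> real" where
  "varU f = covU f f"

definition stdU :: "(real \<Rightarrow> real) \<Rightarrow> real" where
  "stdU f = sqrt (varU f)"

definition corrU :: "(real \<Rightarrow> real) \<Rightarrow> (real \<Rightarrow> real) \<Rightarrow> real" where
  "corrU f h = covU f h / (stdU f * stdU h)"

definition M2 :: "real measure set" where
  "M2 = {G. real_distribution G \<and> integrable G (\<lambda>x. x\<^sup>2)}"

definition quantile :: "real measure \<Rightarrow> real \<Rightarrow> real" where
  "quantile G u = Inf {y. u \<le> cdf G y}"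

definition meanD :: "real measure \<Rightarrow> real" where
  "meanD G = (\<integral>x. x \<partial>G)"

definition stdD :: "real measure \<Rightarrow> real" where
  "stdD G = sqrt ((\<integral>x. x\<^sup>2 \<partial>G) - (meanD G)\<^sup>2)"

definition dWq :: "(real \<Rightarrow> real) \<Rightarrow> (real \<Rightarrow> real) \<Rightarrow> real" where
  "dWq q1 q2 = sqrt (EU (\<lambda>u. (q1 u - q2 u)\<^sup>2))"

definition dW :: "real measure \<Rightarrow> real measure \<Rightarrow> real" where
  "dW G1 G2 = dWq (quantile G1) (quantile G2)"

definition Hq :: "(real \<Rightarrow> real) \<Rightarrow> (real \<Rightarrow> real) \<Rightarrow> real" where
  "Hq g q = EU (\<lambda>u. gam g u * q u)"

definition H :: "(real \<Rightarrow> real) \<Rightarrow> real measure \<Rightarrow> real" where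
  "H g G = Hq g (quantile G)"

definition Meps :: "real measure \<Rightarrow> ereal \<Rightarrow> real \<Rightarrow> real \<Rightarrow> real measure set" where
  "Meps F \<epsilon> \<mu> \<sigma> = {G \<in> M2. (\<integral>x. x \<partial>G) = \<mu> \<and> (\<integral>x. x\<^sup>2 \<partial>G) = \<mu>\<^sup>2 + \<sigma>\<^sup>2 \<and>
      (\<epsilon> = \<infinity> \<or> dW F G \<le> sqrt (real_of_ereal \<epsilon>))}"

definition supH :: "(real \<Rightarrow> real) \<Rightarrow> real measure \<Rightarrow> ereal \<Rightarrow> real \<Rightarrow> real \<Rightarrow> real" where
  "supH g F \<epsilon> \<mu> \<sigma> = Sup (H g ` Meps F \<epsilon> \<mu> \<sigma>)"

definition is_maximiser :: "(real \<Rightarrow> real) \<Rightarrow> real measure \<Rightarrow> ereal \<Rightarrow> real \<Rightarrow> real \<Rightarrow> real measure \<Rightarrow> bool" where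
  "is_maximiser g F \<epsilon> \<mu> \<sigma> G \<longleftrightarrow> G \<in> Meps F \<epsilon> \<mu> \<sigma> \<and> (\<forall>G'\<in>Meps F \<epsilon> \<mu> \<sigma>. H g G' \<le> H g G)"

definition hlam :: "(real \<Rightarrow> real) \<Rightarrow> real measure \<Rightarrow> real \<Rightarrow> real \<Rightarrow> real \<Rightarrow> real \<Rightarrow> real" where
  "hlam g F \<mu> \<sigma> l u =
     (let Z = (\<lambda>v. gam g v + l * quantile F v) in
      \<mu> + \<sigma> * (Z u - EU Z) / stdU Z)"

end

theory Submission
  imports Defs
begin

text \<open>
  Everything takes place among the square integrable functions on \<open>(0,1)\<close>. For a quantile function
  \<open>q\<close> with mean \<open>\<mu>\<close> and standard deviation \<open>\<sigma>\<close>, the objective is \<open>\<mu> + cov(\<gamma>, q)\<close> and the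
  Wasserstein constraint reads \<open>cov(F\<^sup>-\<^sup>1, q) \<ge> K\<close>. Writing \<open>cov(\<gamma>, q) = cov(\<gamma> + \<lambda> F\<^sup>-\<^sup>1, q) - \<lambda> cov(F\<^sup>-\<^sup>1, q)\<close>
  with \<open>\<lambda> \<ge> 0\<close>, the first term is at most \<open>\<sigma> b\<^sub>\<lambda>\<close> by Cauchy-Schwarz, with equality only for \<open>q = h\<^sub>\<lambda>\<close>,
  and the second is at most \<open>- \<lambda> K\<close>, with equality when the constraint binds. Concavity of \<open>g\<close> makes \<open>\<gamma>\<close>
  nondecreasing, so that \<open>h\<^sub>\<lambda>\<close> is almost everywhere a quantile function and \<open>cov(\<gamma>, F\<^sup>-\<^sup>1) \<ge> 0\<close>.
\<close>

section \<open>Concave functions: left derivatives and their integration\<close>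

lemma concave_on_slopes:
  fixes g :: "real \<Rightarrow> real"
  assumes g: "concave_on {a..b} g" and "a \<le> y" "y < w" "w < z" "z \<le> b"
  shows "(g z - g w) * (w - y) \<le> (g w - g y) * (z - w)"
proof -
  define t where "t = (w - y) / (z - y)"
  have t: "0 \<le> t" "t \<le> 1" "(z - y) * t = w - y" using assms by (auto simp: t_def field_simps)
  have w: "(1 - t) * y + t * z = w" using t(3) by (simp add: algebra_simps)
  have "(1 - t) * g y + t * g z \<le> g ((1 - t) *\<^sub>R y + t *\<^sub>R z)"
    by (rule concave_onD[OF g]) (use assms t in auto)
  then have "(1 - t) * g y + t * g z \<le> g w" using w by simp
  then have "(z - y) * ((1 - t) * g y + t * g z) \<le> (z - y) * g w"
    by (rule mult_left_mono) (use assms in auto)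
  also have "(z - y) * ((1 - t) * g y + t * g z) = (z - y) * g y + ((z - y) * t) * (g z - g y)"
    by (simp add: algebra_simps)
  finally show ?thesis unfolding t(3) by (simp add: algebra_simps)
qed

text \<open>\<open>Lim\<close> is informative only if the limit exists. The secant slopes ending at
  \<open>x\<close> decrease as their left end approaches \<open>x\<close> and stay above every
  secant slope to the right of \<open>x\<close>, so they converge to their infimum; both
  inequalities compare one secant with that infimum.\<close>

lemma concave_on_left_deriv:
  fixes g :: "real \<Rightarrow> real"
  assumes g: "concave_on {a..b} g" and x: "a < x" "x < b"
  shows "a \<le> y \<Longrightarrow> y < x \<Longrightarrow> left_deriv g x * (x - y) \<le> g x - g y"
    and "x < z \<Longrightarrow> z \<le> b \<Longrightarrow> g z - g x \<le> left_deriv g x * (z - x)"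
proof -
  define s where "s y = (g x - g y) / (x - y)" for y
  define I where "I = {..<x} \<inter> {a..}"
  have bnd: "- s y \<le> - ((g z - g x) / (z - x))" if "y \<in> I" "x < z" "z \<le> b" for y z
    using concave_on_slopes[OF g, of y x z] that unfolding s_def I_def
    by (simp add: divide_simps) (simp add: algebra_simps)
  have mono: "- s y \<le> - s w" if "y \<in> {a..}" "w \<in> {a..}" "w < x" "y \<le> w" for y w
  proof (cases "y = w")
    case False
    then have *: "(g x - g w) * (w - y) \<le> (g w - g y) * (x - w)"
      using concave_on_slopes[OF g, of y w x] that x by auto
    have "(g x - g w) * (x - y) \<le> (g x - g y) * (x - w)"
      using * by (simp add: algebra_simps)
    then show ?thesis using that False unfolding s_def
      by (simp add: divide_simps) (simp add: algebra_simps)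
  qed simp
  \<comment> \<open>\<open>Lim_left_bound\<close> treats nondecreasing functions, hence the negated
    slopes.\<close>
  have "((\<lambda>y. - s y) \<longlongrightarrow> Sup ((\<lambda>y. - s y) ` I)) (at x within I)"
    unfolding I_def using x bnd[of _ b, unfolded I_def]
    by (intro Lim_left_bound[where K = "- ((g b - g x) / (b - x))"] mono) auto
  moreover have "at x within I = at_left x"
    by (rule at_within_nhd[of _ "{a<..}"]) (use x in \<open>auto simp: I_def\<close>)
  ultimately have "(s \<longlongrightarrow> - Sup ((\<lambda>y. - s y) ` I)) (at_left x)"
    using tendsto_minus_cancel_left by force
  then have L: "left_deriv g x = - Sup ((\<lambda>y. - s y) ` I)"
    unfolding left_deriv_def s_def[abs_def] by (intro tendsto_Lim) auto
  have bdd: "bdd_above ((\<lambda>y. - s y) ` I)"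
    using bnd[of _ b] x by (intro bdd_aboveI2[where M = "- ((g b - g x) / (b - x))"]) auto
  show "left_deriv g x * (x - y) \<le> g x - g y" if "a \<le> y" "y < x"
  proof -
    have "- s y \<le> - left_deriv g x"
      unfolding L minus_minus by (rule cSUP_upper[OF _ bdd]) (use that in \<open>auto simp: I_def\<close>)
    then show ?thesis using that by (simp add: s_def field_simps)
  qed
  show "g z - g x \<le> left_deriv g x * (z - x)" if "x < z" "z \<le> b"
  proof -
    have "- left_deriv g x \<le> - ((g z - g x) / (z - x))"
      unfolding L minus_minus
    proof (rule cSup_least)
      show "(\<lambda>y. - s y) ` I \<noteq> {}" using x by (auto simp: I_def intro!: exI[of _ a])
    qed (use bnd that in auto)
    then show ?thesis using that by (simp add: field_simps)
  qed
qed

text \<open>A fundamental theorem without derivatives: \<open>D\<close>, the difference of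
  \<open>G\<close> and the integral of \<open>\<phi>\<close>, is constant. On \<open>[u, v]\<close>
  both increments lie between \<open>\<phi> u * (v - u)\<close> and
  \<open>\<phi> v * (v - u)\<close>, so \<open>D\<close> changes by at most the difference of these
  bounds, an error that subdivision makes arbitrarily small.\<close>

lemma integral_monotone_subgradient:
  fixes \<phi> G :: "real \<Rightarrow> real"
  assumes ab: "a < b" and cont: "continuous_on {a..b} G" and int: "\<phi> integrable_on {a..b}"
    and mono: "mono_on {a<..<b} \<phi>"
    and lower: "\<And>u v. a < u \<Longrightarrow> u < v \<Longrightarrow> v < b \<Longrightarrow> \<phi> u * (v - u) \<le> G v - G u"
    and upper: "\<And>u v. a < u \<Longrightarrow> u < v \<Longrightarrow> v < b \<Longrightarrow> G v - G u \<le> \<phi> v * (v - u)"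
  shows "integral {a..b} \<phi> = G b - G a"
proof -
  define D where "D u = G u - integral {a..u} \<phi>" for u
  have step: "\<bar>D v - D u\<bar> \<le> (\<phi> v - \<phi> u) * (v - u)" if uv: "a < u" "u \<le> v" "v < b" for u v
  proof (cases "u = v")
    case False
    then have "u < v" using uv by simp
    have iuv: "\<phi> integrable_on {u..v}" and iav: "\<phi> integrable_on {a..v}"
      using int uv by (auto intro: integrable_on_subinterval)
    have "integral {a..u} \<phi> + integral {u..v} \<phi> = integral {a..v} \<phi>"
      using uv by (intro Henstock_Kurzweil_Integration.integral_combine iav) auto
    moreover have "integral {u..v} (\<lambda>_. \<phi> u) \<le> integral {u..v} \<phi>"
      using uv iuv by (intro integral_le) (auto intro!: mono_onD[OF mono])
    moreover have "integral {u..v} \<phi> \<le> integral {u..v} (\<lambda>_. \<phi> v)"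
      using uv iuv by (intro integral_le) (auto intro!: mono_onD[OF mono])
    ultimately show ?thesis
      using lower[of u v] upper[of u v] uv \<open>u < v\<close> by (auto simp: D_def algebra_simps abs_le_iff)
  qed simp
  have const: "D v = D u" if uv: "a < u" "u \<le> v" "v < b" for u v
  proof -
    \<comment> \<open>On \<open>n\<close> equal pieces the increments of \<open>\<phi>\<close>
      telescope, so the errors add up to the one-piece bound divided by \<open>n\<close>.\<close>
    have le: "\<bar>D v - D u\<bar> * real n \<le> (\<phi> v - \<phi> u) * (v - u)" if n: "n > 0" for n :: nat
    proof -
      define p where "p i = u + real i * ((v - u) / real n)" for i :: nat
      have p0: "p 0 = u" "p n = v" using n by (auto simp: p_def)
      have pmono: "p i \<le> p j" if "i \<le> j" for i j
        using that uv unfolding p_def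
        by (intro add_left_mono mult_right_mono divide_nonneg_nonneg) auto
      have pd: "p (Suc i) - p i = (v - u) / real n" for i
        by (simp add: p_def distrib_right add_divide_distrib)
      have "D v - D u = (\<Sum>i<n. D (p (Suc i)) - D (p i))"
        using sum_lessThan_telescope[of "\<lambda>i. D (p i)" n] p0 by simp
      then have "\<bar>D v - D u\<bar> \<le> (\<Sum>i<n. \<bar>D (p (Suc i)) - D (p i)\<bar>)"
        by (simp add: sum_abs)
      also have "\<dots> \<le> (\<Sum>i<n. (\<phi> (p (Suc i)) - \<phi> (p i)) * (p (Suc i) - p i))"
      proof (rule sum_mono)
        fix i assume "i \<in> {..<n}"
        then show "\<bar>D (p (Suc i)) - D (p i)\<bar> \<le> (\<phi> (p (Suc i)) - \<phi> (p i)) * (p (Suc i) - p i)"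
          using pmono[of 0 i] pmono[of i "Suc i"] pmono[of "Suc i" n] p0 uv by (intro step) auto
      qed
      also have "\<dots> = (\<Sum>i<n. \<phi> (p (Suc i)) - \<phi> (p i)) * ((v - u) / real n)"
        by (simp only: pd sum_distrib_right)
      also have "\<dots> = (\<phi> v - \<phi> u) * ((v - u) / real n)"
        using sum_lessThan_telescope[of "\<lambda>i. \<phi> (p i)" n] p0 by simp
      finally show ?thesis using n by (simp add: field_simps)
    qed
    show ?thesis
    proof (rule ccontr)
      assume "D v \<noteq> D u"
      then have pos: "\<bar>D v - D u\<bar> > 0" by simp
      then obtain n :: nat where "(\<phi> v - \<phi> u) * (v - u) < real n * \<bar>D v - D u\<bar>"
        using reals_Archimedean3 by blast
      also have "\<dots> \<le> real (Suc n) * \<bar>D v - D u\<bar>" by (intro mult_right_mono) auto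
      finally show False using le[of "Suc n"] by (simp add: mult.commute)
    qed
  qed
  \<comment> \<open>\<open>\<phi>\<close> is controlled only on the open interval; continuity
    carries the constancy of \<open>D\<close> to the endpoints.\<close>
  define m where "m = (a + b) / 2"
  have m: "a < m" "m < b" using ab by (auto simp: m_def)
  have cl: "closure {a<..<b} = {a..b}" using ab by simp
  have "continuous_on {a..b} D"
    unfolding D_def by (intro continuous_intros cont indefinite_integral_continuous_1 int)
  moreover have "D x = D m" if "x \<in> {a<..<b}" for x
    using const[of m x] const[of x m] m that by (cases "m \<le> x") auto
  ultimately have "D x = D m" if "x \<in> {a..b}" for x
    using that by (intro continuous_constant_on_closure[of "{a<..<b}" D "D m" x]) (simp_all only: cl)
  from this[of a] this[of b] ab show ?thesis by (simp add: D_def)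
qed

lemma abs_cont_on_imp_continuous_on:
  assumes "abs_cont_on S g"
  shows "continuous_on S g"
proof (rule continuous_onI)
  fix x e :: real assume x: "x \<in> S" and e: "0 < e"
  obtain d where d: "d > 0" and *: "\<And>(n::nat) (a::nat\<Rightarrow>real) b.
       (\<forall>i<n. a i \<in> S \<and> b i \<in> S \<and> a i \<le> b i) \<and>
       (\<forall>i<n. \<forall>j<n. i \<noteq> j \<longrightarrow> b i \<le> a j \<or> b j \<le> a i) \<and>
       (\<Sum>i<n. b i - a i) < d
       \<Longrightarrow> (\<Sum>i<n. \<bar>g (b i) - g (a i)\<bar>) < e"
    using assms e unfolding abs_cont_on_def by blast
  \<comment> \<open>A family of one interval, with its endpoints put in order.\<close>
  have "dist (g y) (g x) \<le> e" if "y \<in> S" "dist y x < d" for y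
    using *[of 1 "\<lambda>_. min x y" "\<lambda>_. max x y"] x that
    by (cases "x \<le> y") (auto simp: dist_real_def min_def max_def abs_minus_commute)
  then show "\<exists>d>0. \<forall>y\<in>S. dist y x < d \<longrightarrow> dist (g y) (g x) \<le> e" using d by blast
qed

section \<open>Square integrable functions of a uniform variable\<close>

abbreviation unif :: "real measure" where
  "unif \<equiv> restrict_space lborel {0<..<1}"

definition L2U :: "(real \<Rightarrow> real) set" where
  "L2U = {f \<in> borel_measurable unif. integrable unif (\<lambda>u. (f u)\<^sup>2)}"

lemma prob_space_unif: "prob_space unif"
  by (auto simp: emeasure_restrict_space space_restrict_space intro!: prob_spaceI)

interpretation unif: prob_space unif
  by (rule prob_space_unif)

lemma EU_eq: "EU f = integral\<^sup>L unif f"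
  by (simp add: EU_def set_lebesgue_integral_def integral_restrict_space)

lemma AE_unif: "(AE u in unif. P u) \<longleftrightarrow> (AE u in lborel. u \<in> {0<..<1} \<longrightarrow> P u)"
  by (rule AE_restrict_space_iff) simp

lemma mono_on_measurable_unif:
  fixes f :: "real \<Rightarrow> real"
  assumes "mono_on {0<..<1} f"
  shows "f \<in> borel_measurable unif"
  using borel_measurable_mono_on_fnc[OF assms] 
  by (simp add: measurable_cong_sets sets_restrict_space cong: measurable_cong_sets)

lemma L2U_measurable [measurable_dest]: "f \<in> L2U \<Longrightarrow> f \<in> borel_measurable unif"
  by (simp add: L2U_def)

lemma L2U_integrable_mult:
  assumes "f \<in> L2U" "h \<in> L2U"
  shows "integrable unif (\<lambda>u. f u * h u)"
proof (rule Bochner_Integration.integrable_bound)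
  show "integrable unif (\<lambda>u. (f u)\<^sup>2 + (h u)\<^sup>2)"
    using assms by (auto simp: L2U_def)
  show "(\<lambda>u. f u * h u) \<in> borel_measurable unif"
    using assms by (auto simp: L2U_def)
  have "\<bar>x * y\<bar> \<le> x\<^sup>2 + y\<^sup>2" for x y :: real
    using sum_squares_bound[of "\<bar>x\<bar>" "\<bar>y\<bar>"] abs_ge_zero[of "x * y"]
    by (simp only: abs_mult mult.assoc power2_abs)
  then show "AE u in unif. norm (f u * h u) \<le> norm ((f u)\<^sup>2 + (h u)\<^sup>2)"
    by auto
qed

lemma L2U_const: "(\<lambda>_. c) \<in> L2U"
  by (simp add: L2U_def)

lemma L2U_integrable: "f \<in> L2U \<Longrightarrow> integrable unif f"
  using L2U_integrable_mult[OF _ L2U_const[of 1], of f] by simp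

lemma L2U_add: "f \<in> L2U \<Longrightarrow> h \<in> L2U \<Longrightarrow> (\<lambda>u. f u + h u) \<in> L2U"
  using L2U_integrable_mult[of f h] by (auto simp: L2U_def power2_sum mult.assoc)

lemma L2U_cmult: "f \<in> L2U \<Longrightarrow> (\<lambda>u. c * f u) \<in> L2U"
  by (auto simp: L2U_def power_mult_distrib)

lemma EU_const: "EU (\<lambda>_. c) = c"
  using unif.prob_space by (simp add: EU_eq)

lemma EU_add: "integrable unif f \<Longrightarrow> integrable unif h \<Longrightarrow> EU (\<lambda>u. f u + h u) = EU f + EU h"
  by (simp add: EU_eq)

lemma EU_cmult: "EU (\<lambda>u. c * f u) = c * EU f"
  by (simp add: EU_eq)

lemma EU_cong_AE:
  assumes "AE u in unif. f u = h u" "f \<in> borel_measurable unif" "h \<in> borel_measurable unif"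
  shows "EU f = EU h"
  unfolding EU_eq by (intro integral_cong_AE assms)

lemma covU_commute: "covU f h = covU h f"
  by (simp add: covU_def mult.commute)

lemma covU_add_left:
  assumes "f \<in> L2U" "f' \<in> L2U" "h \<in> L2U"
  shows "covU (\<lambda>u. f u + f' u) h = covU f h + covU f' h"
  using assms L2U_integrable_mult
  by (simp add: covU_def distrib_right EU_add L2U_integrable)

lemma covU_cmult_left: "covU (\<lambda>u. c * f u) h = c * covU f h"
  by (simp add: covU_def mult.assoc EU_cmult right_diff_distrib)

lemma covU_const_left: "covU (\<lambda>_. c) h = 0"
  by (simp add: covU_def EU_cmult EU_const)

lemma covU_cong_AE:
  assumes "AE u in unif. f u = f' u" "f \<in> L2U" "f' \<in> L2U" "h \<in> L2U"
  shows "covU f h = covU f' h"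
proof -
  have "EU (\<lambda>u. f u * h u) = EU (\<lambda>u. f' u * h u)"
    using assms by (intro EU_cong_AE) (auto simp: L2U_def)
  moreover have "EU f = EU f'" using assms by (intro EU_cong_AE) (auto simp: L2U_def)
  ultimately show ?thesis by (simp add: covU_def)
qed

text \<open>Reduces the Wasserstein distance between quantile functions with prescribed means and
  variances to their covariance.\<close>

lemma EU_diff_squared:
  assumes "p \<in> L2U" "q \<in> L2U"
  shows "EU (\<lambda>u. (p u - q u)\<^sup>2) = (EU p - EU q)\<^sup>2 + varU p + varU q - 2 * covU p q"
proof -
  have "(\<lambda>u. (p u - q u)\<^sup>2) = (\<lambda>u. p u * p u + (q u * q u + (- 2) * (p u * q u)))"
    by (auto simp: power2_eq_square algebra_simps)
  then have "EU (\<lambda>u. (p u - q u)\<^sup>2)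
      = EU (\<lambda>u. p u * p u) + (EU (\<lambda>u. q u * q u) + (- 2) * EU (\<lambda>u. p u * q u))"
    using assms by (simp only: EU_add EU_cmult L2U_integrable_mult
        Bochner_Integration.integrable_add integrable_mult_right)
  then show ?thesis by (simp add: varU_def covU_def power2_eq_square algebra_simps)
qed

lemma EU_diff_squared_eq_0_iff:
  assumes "p \<in> L2U" "q \<in> L2U"
  shows "EU (\<lambda>u. (p u - q u)\<^sup>2) = 0 \<longleftrightarrow> (AE u in unif. p u = q u)"
proof -
  have "(\<lambda>u. p u + (-1) * q u) \<in> L2U" using assms by (intro L2U_add L2U_cmult)
  then have "integrable unif (\<lambda>u. (p u - q u)\<^sup>2)" by (simp add: L2U_def)
  from integral_nonneg_eq_0_iff_AE[OF this] show ?thesis by (simp add: EU_eq)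
qed

text \<open>Integrating \<open>(f u - f v) * (h u - h v) \<ge> 0\<close> first in \<open>u\<close> and then in \<open>v\<close> avoids Fubini.\<close>

lemma covU_mono_nonneg:
  assumes f: "f \<in> L2U" "mono_on {0<..<1} f" and h: "h \<in> L2U" "mono_on {0<..<1} h"
  shows "0 \<le> covU f h"
proof -
  note int = L2U_integrable_mult L2U_integrable Bochner_Integration.integrable_add integrable_mult_right
  have step: "0 \<le> EU (\<lambda>u. f u * h u) + (f v * h v + ((- EU h) * f v + (- EU f) * h v))"
    if v: "v \<in> {0<..<1}" for v
  proof -
    have "0 \<le> EU (\<lambda>u. (f u - f v) * (h u - h v))"
      unfolding EU_eq
    proof (rule integral_nonneg_AE, rule AE_I2)
      fix u assume "u \<in> space unif"
      then have u: "u \<in> {0<..<1}" by simp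
      show "0 \<le> (f u - f v) * (h u - h v)"
        using mono_onD[OF f(2) u v] mono_onD[OF f(2) v u] mono_onD[OF h(2) u v] mono_onD[OF h(2) v u]
        by (cases "u \<le> v") (auto intro: mult_nonneg_nonneg mult_nonpos_nonpos)
    qed
    also have "(\<lambda>u. (f u - f v) * (h u - h v))
        = (\<lambda>u. f u * h u + (f v * h v + ((- h v) * f u + (- f v) * h u)))"
      by (auto simp: algebra_simps)
    also have "EU \<dots> = EU (\<lambda>u. f u * h u) + (f v * h v + ((- h v) * EU f + (- f v) * EU h))"
      using f h by (simp only: EU_add EU_const EU_cmult int integrable_const unif.integrable_const)
    finally show ?thesis by (simp add: algebra_simps)
  qed
  \<comment> \<open>Integrating in \<open>v\<close> yields twice the covariance.\<close>
  have "0 \<le> EU (\<lambda>v. EU (\<lambda>u. f u * h u) + (f v * h v + ((- EU h) * f v + (- EU f) * h v)))"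
    (is "0 \<le> EU ?k")
    unfolding EU_eq[of ?k] by (rule integral_nonneg_AE, rule AE_I2, rule step) simp
  also have "EU ?k = EU (\<lambda>u. f u * h u) + (EU (\<lambda>u. f u * h u) + ((- EU h) * EU f + (- EU f) * EU h))"
    using f h by (simp only: EU_add EU_const EU_cmult int unif.integrable_const)
  finally show ?thesis by (simp add: covU_def algebra_simps)
qed

section \<open>Quantile functions and their laws\<close>

text \<open>The pseudoinverse \<open>I\<close> of the locale \<open>cdf_distribution\<close>, which
  comes from the Skorohod construction, is the quantile function.\<close>

lemma
  assumes "G \<in> M2"
  shows quantile_mono: "mono_on {0<..<1} (quantile G)"
    and distr_quantile: "distr unif borel (quantile G) = G"
proof -
  interpret cdf_distribution G
    using assms by (simp add: cdf_distribution_def M2_def)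
  have "quantile G = I" by (auto simp: quantile_def)
  then show "mono_on {0<..<1} (quantile G)" "distr unif borel (quantile G) = G"
    using mono_I distr_I_eq_M by simp_all
qed

lemma
  assumes G: "G \<in> M2"
  shows quantile_L2U: "quantile G \<in> L2U"
    and EU_quantile: "EU (quantile G) = (\<integral>x. x \<partial>G)"
    and EU_quantile_squared: "EU (\<lambda>u. quantile G u * quantile G u) = (\<integral>x. x\<^sup>2 \<partial>G)"
proof -
  note m = mono_on_measurable_unif[OF quantile_mono[OF G]]
  note d = distr_quantile[OF G]
  have "integrable (distr unif borel (quantile G)) (\<lambda>x. x\<^sup>2)"
    using G unfolding d by (simp add: M2_def)
  then show "quantile G \<in> L2U"
    using m by (simp add: L2U_def integrable_distr_eq)
  have "(\<integral>x. x \<partial>distr unif borel (quantile G)) = EU (quantile G)"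
    using m by (simp add: integral_distr EU_eq)
  then show "EU (quantile G) = (\<integral>x. x \<partial>G)" unfolding d by simp
  have "(\<integral>x. x\<^sup>2 \<partial>distr unif borel (quantile G)) = EU (\<lambda>u. quantile G u * quantile G u)"
    using m by (simp add: integral_distr EU_eq power2_eq_square)
  then show "EU (\<lambda>u. quantile G u * quantile G u) = (\<integral>x. x\<^sup>2 \<partial>G)" unfolding d by simp
qed

text \<open>The quantile function of the law of \<open>q\<close> lies below \<open>q\<close> pointwise and has the same mean,
  so the two agree almost everywhere.\<close>

lemma quantile_distr_mono:
  assumes q: "q \<in> L2U" "mono_on {0<..<1} q"
  shows "distr unif borel q \<in> M2" "AE u in unif. quantile (distr unif borel q) u = q u"
proof -
  let ?G = "distr unif borel q"
  note m [measurable] = L2U_measurable[OF q(1)]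
  show G: "?G \<in> M2"
    using q m by (simp add: M2_def integrable_distr_eq L2U_def)
  have le: "quantile ?G u \<le> q u" if u: "u \<in> {0<..<1}" for u
  proof -
    interpret cdf_distribution ?G
      using G by (simp add: cdf_distribution_def M2_def)
    \<comment> \<open>Monotonicity sends \<open>{0<..u}\<close> into \<open>{..q u}\<close>, so the
      cdf at \<open>q u\<close> is at least \<open>u\<close>; \<open>pseudoinverse\<close> is the
      Galois connection that turns this into a bound on the quantile.\<close>
    have "u = measure unif {0<..u}"
      using u by (subst measure_restrict_space) auto
    also have "\<dots> \<le> measure unif (q -` {..q u} \<inter> space unif)"
      using u mono_onD[OF q(2) _ u]
      by (intro unif.finite_measure_mono measurable_sets[OF m]) auto
    also have "\<dots> = cdf ?G (q u)"
      by (simp add: cdf_def measure_distr)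
    finally show ?thesis
      using pseudoinverse[of u "q u"] u by (simp add: quantile_def)
  qed
  note qL = quantile_L2U[OF G]
  have "EU (quantile ?G) = EU q"
    unfolding EU_quantile[OF G] by (simp add: integral_distr EU_eq)
  then have "(\<integral>u. q u - quantile ?G u \<partial>unif) = 0"
    using qL q(1) L2U_integrable by (simp add: EU_eq)
  moreover have "AE u in unif. 0 \<le> q u - quantile ?G u"
    using le by (intro AE_I2) simp
  ultimately have "AE u in unif. q u - quantile ?G u = 0"
    using qL q(1) L2U_integrable by (subst (asm) integral_nonneg_eq_0_iff_AE) auto
  then show "AE u in unif. quantile ?G u = q u" by eventually_elim simp
qed

section \<open>The weight function of a concave distortion\<close>

text \<open>The reflection \<open>\<lambda>u. - g (1 - u)\<close> is convex, and the left derivative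
  of \<open>g\<close> at \<open>1 - u\<close> is its right derivative at \<open>u\<close>, hence a
  subgradient.\<close>

lemma gam_subgradient:
  assumes "concave_on {0..1} g" "0 < u" "u < v" "v < 1"
  shows "gam g u * (v - u) \<le> - g (1 - v) - - g (1 - u)"
    and "- g (1 - v) - - g (1 - u) \<le> gam g v * (v - u)"
  using concave_on_left_deriv(1)[OF assms(1), of "1 - u" "1 - v"]
    concave_on_left_deriv(2)[OF assms(1), of "1 - v" "1 - u"] assms by (auto simp: gam_def)

lemma gam_mono:
  assumes "concave_on {0..1} g"
  shows "mono_on {0<..<1} (gam g)"
proof (rule mono_onI)
  fix u v :: real assume uv: "u \<in> {0<..<1}" "v \<in> {0<..<1}" "u \<le> v"
  show "gam g u \<le> gam g v"
  proof (cases "u = v")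
    case False
    then have "gam g u * (v - u) \<le> gam g v * (v - u)"
      using order_trans[OF gam_subgradient[OF assms, of u v]] uv by simp
    then show ?thesis using False uv by simp
  qed simp
qed

lemma gam_L2U:
  assumes "concave_on {0..1} g" "set_integrable lborel {0<..<1} (\<lambda>u. (gam g u)\<^sup>2)"
  shows "gam g \<in> L2U"
  using assms mono_on_measurable_unif[OF gam_mono]
  by (simp add: L2U_def integrable_restrict_space set_integrable_def)

text \<open>The reflection of \<open>g\<close> is recovered by integrating its subgradients.
  Continuity at the endpoints matters: the integral would miss a jump of \<open>g\<close>
  there.\<close>

lemma EU_gam:
  assumes g: "concave_on {0..1} g" "continuous_on {0..1} g" "gam g \<in> L2U"
  shows "EU (gam g) = g 1 - g 0"
proof -
  have si: "set_integrable lborel {0<..<1} (gam g)"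
    using L2U_integrable[OF g(3)] by (simp add: integrable_restrict_space set_integrable_def)
  have "EU (gam g) = integral {0..1} (gam g)"
    unfolding EU_def set_borel_integral_eq_integral(2)[OF si] by (rule integral_open_interval_real[symmetric])
  also have "\<dots> = - g (1 - 1) - - g (1 - 0)"
  proof (rule integral_monotone_subgradient)
    show "continuous_on {0..1} (\<lambda>u. - g (1 - u))"
      by (intro continuous_intros continuous_on_compose2[OF g(2)]) auto
    show "gam g integrable_on {0..1}"
      using set_borel_integral_eq_integral(1)[OF si] by (simp add: integrable_on_open_interval_real)
  qed (use gam_mono gam_subgradient g(1) in auto)
  finally show ?thesis by simp
qed

section \<open>Standardised functions and the Cauchy-Schwarz deficit\<close>

text \<open>For \<open>\<sigma> > 0\<close> and \<open>varU Z > 0\<close> this is, among functions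
  with mean \<open>\<mu>\<close> and standard deviation \<open>\<sigma>\<close>, the one perfectly
  correlated with \<open>Z\<close>.\<close>

definition rescale :: "real \<Rightarrow> real \<Rightarrow> (real \<Rightarrow> real) \<Rightarrow> real \<Rightarrow> real" where
  "rescale \<mu> \<sigma> Z u = \<mu> + \<sigma> * (Z u - EU Z) / stdU Z"

lemma hlam_eq_rescale: "hlam g F \<mu> \<sigma> l = rescale \<mu> \<sigma> (\<lambda>u. gam g u + l * quantile F u)"
  by (simp add: fun_eq_iff hlam_def rescale_def Let_def)

lemma rescale_affine:
  "rescale \<mu> \<sigma> Z = (\<lambda>u. \<sigma> / stdU Z * Z u + (\<mu> - \<sigma> * EU Z / stdU Z))"
  by (simp add: fun_eq_iff rescale_def algebra_simps diff_divide_distrib)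

lemma rescale_mono:
  assumes "mono_on {0<..<1} Z" "\<sigma> > 0" "varU Z > 0"
  shows "mono_on {0<..<1} (rescale \<mu> \<sigma> Z)"
  using assms(2,3) unfolding rescale_affine stdU_def
  by (intro mono_onI add_right_mono mult_left_mono mono_onD[OF assms(1)]) auto

lemma
  assumes Z: "Z \<in> L2U" "varU Z > 0"
  shows rescale_L2U: "rescale \<mu> \<sigma> Z \<in> L2U"
    and EU_rescale: "EU (rescale \<mu> \<sigma> Z) = \<mu>"
    and covU_rescale: "f \<in> L2U \<Longrightarrow> covU f (rescale \<mu> \<sigma> Z) = \<sigma> / stdU Z * covU f Z"
    and varU_rescale: "varU (rescale \<mu> \<sigma> Z) = \<sigma>\<^sup>2"
proof -
  show L2: "rescale \<mu> \<sigma> Z \<in> L2U"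
    unfolding rescale_affine by (intro L2U_add L2U_cmult L2U_const Z)
  have b: "stdU Z > 0" "stdU Z * stdU Z = varU Z" using Z by (auto simp: stdU_def)
  show "EU (rescale \<mu> \<sigma> Z) = \<mu>"
    unfolding rescale_affine
    using EU_add[OF L2U_integrable[OF L2U_cmult[OF Z(1)]] L2U_integrable[OF L2U_const]]
    by (simp only: EU_cmult EU_const) simp
  have cov: "covU f (rescale \<mu> \<sigma> Z) = \<sigma> / stdU Z * covU f Z" if "f \<in> L2U" for f
    unfolding rescale_affine covU_commute[of f]
    using covU_add_left[OF L2U_cmult[OF Z(1)] L2U_const that]
    by (simp only: covU_cmult_left covU_const_left add_0_right)
  then show "f \<in> L2U \<Longrightarrow> covU f (rescale \<mu> \<sigma> Z) = \<sigma> / stdU Z * covU f Z" .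
  have "varU (rescale \<mu> \<sigma> Z) = (\<sigma> / stdU Z) * ((\<sigma> / stdU Z) * varU Z)"
    unfolding varU_def cov[OF L2] covU_commute[of "rescale \<mu> \<sigma> Z" Z] cov[OF Z(1)] ..
  also have "\<dots> = \<sigma>\<^sup>2 * (varU Z / (stdU Z * stdU Z))" by (simp add: power2_eq_square)
  also have "\<dots> = \<sigma>\<^sup>2" unfolding b(2) using Z(2) by simp
  finally show "varU (rescale \<mu> \<sigma> Z) = \<sigma>\<^sup>2" .
qed

text \<open>Cauchy-Schwarz with an explicit deficit, which also settles the equality case.\<close>

lemma covU_eq_deficit:
  assumes Z: "Z \<in> L2U" "varU Z > 0" and q: "q \<in> L2U" "EU q = \<mu>" "varU q = \<sigma>\<^sup>2" and \<sigma>: "\<sigma> > 0"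
  shows "covU Z q = \<sigma> * stdU Z - stdU Z / (2 * \<sigma>) * EU (\<lambda>u. (q u - rescale \<mu> \<sigma> Z u)\<^sup>2)"
proof -
  have b: "stdU Z > 0" using Z by (simp add: stdU_def)
  \<comment> \<open>Both functions have the same mean and variance, so only their covariance varies
    in the squared distance.\<close>
  have "EU (\<lambda>u. (q u - rescale \<mu> \<sigma> Z u)\<^sup>2) = 2 * \<sigma>\<^sup>2 - 2 * (\<sigma> / stdU Z * covU Z q)"
    using Z q
    by (simp add: EU_diff_squared rescale_L2U EU_rescale varU_rescale covU_rescale covU_commute[of q Z])
  then show ?thesis using b \<sigma> by (simp add: field_simps power2_eq_square)
qed

section \<open>The uncertainty set and Lagrangian optimality\<close>

lemma varU_quantile:
  assumes G: "G \<in> M2"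
  shows "varU (quantile G) = (\<integral>x. x\<^sup>2 \<partial>G) - (\<integral>x. x \<partial>G)\<^sup>2"
  using EU_quantile[OF G] EU_quantile_squared[OF G] by (simp add: varU_def covU_def power2_eq_square)

lemma
  assumes F: "F \<in> M2" "stdD F > 0"
  shows EU_quantile_eq_meanD: "EU (quantile F) = meanD F"
    and varU_quantile_eq_stdD: "varU (quantile F) = (stdD F)\<^sup>2"
proof -
  show "EU (quantile F) = meanD F" using EU_quantile[OF F(1)] by (simp add: meanD_def)
  have "(\<integral>x. x\<^sup>2 \<partial>F) - (meanD F)\<^sup>2 > 0" using F(2) by (simp add: stdD_def)
  then show "varU (quantile F) = (stdD F)\<^sup>2"
    using varU_quantile[OF F(1)] by (simp add: stdD_def meanD_def)
qed

text \<open>The constant \<open>K\<close> of the theorem: the covariance with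
  \<open>quantile F\<close> at which a quantile function with mean \<open>\<mu>\<close> and standard
  deviation \<open>\<sigma>\<close> has squared distance exactly \<open>\<epsilon>\<close> from that
  of \<open>F\<close>.\<close>

definition cov_bound :: "real measure \<Rightarrow> real \<Rightarrow> real \<Rightarrow> real \<Rightarrow> real" where
  "cov_bound F \<mu> \<sigma> \<epsilon> = ((meanD F)\<^sup>2 + (stdD F)\<^sup>2 + \<mu>\<^sup>2 + \<sigma>\<^sup>2 - 2 * \<mu> * meanD F - \<epsilon>) / 2"

text \<open>Here \<open>\<epsilon>\<close> is arbitrary, as it cancels against the one in
  \<open>cov_bound\<close>; this form shows the distance constraint as the sign of a difference of
  covariances.\<close>

lemma EU_diff_quantile_squared:
  assumes F: "F \<in> M2" "stdD F > 0" and q: "q \<in> L2U" "EU q = \<mu>" "varU q = \<sigma>\<^sup>2"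
  shows "EU (\<lambda>u. (quantile F u - q u)\<^sup>2) = \<epsilon> + 2 * (cov_bound F \<mu> \<sigma> \<epsilon> - covU (quantile F) q)"
  using EU_diff_squared[OF quantile_L2U[OF F(1)] q(1)]
    EU_quantile_eq_meanD[OF F] varU_quantile_eq_stdD[OF F] q(2,3)
  by (simp add: cov_bound_def power2_diff[of "meanD F"] field_simps)

text \<open>With the first two moments fixed, the Wasserstein ball is a half-space in the quantile
  function.\<close>

lemma mem_Meps_iff:
  assumes F: "F \<in> M2" "stdD F > 0" and G: "G \<in> M2"
  shows "G \<in> Meps F \<epsilon> \<mu> \<sigma> \<longleftrightarrow> EU (quantile G) = \<mu> \<and> varU (quantile G) = \<sigma>\<^sup>2 \<and>
    (\<epsilon> = \<infinity> \<or> cov_bound F \<mu> \<sigma> (real_of_ereal \<epsilon>) \<le> covU (quantile F) (quantile G))"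
proof -
  have "dW F G \<le> sqrt e \<longleftrightarrow> cov_bound F \<mu> \<sigma> e \<le> covU (quantile F) (quantile G)"
    if "EU (quantile G) = \<mu>" "varU (quantile G) = \<sigma>\<^sup>2" for e
    using EU_diff_quantile_squared[OF F quantile_L2U[OF G] that, of e]
    by (simp add: dW_def dWq_def)
  then show ?thesis
    using G unfolding Meps_def varU_quantile[OF G] EU_quantile[OF G] by auto
qed

text \<open>Lagrangian sufficiency with multiplier \<open>l\<close> of the Wasserstein constraint; the last assumption
  is primal feasibility together with complementary slackness.\<close>

lemma maximiser_rescale:
  fixes l :: real and g :: "real \<Rightarrow> real" and F :: "real measure"
  defines "Z \<equiv> \<lambda>u. gam g u + l * quantile F u"
  assumes F: "F \<in> M2" "stdD F > 0" and \<gamma>: "gam g \<in> L2U" "mono_on {0<..<1} (gam g)" "EU (gam g) = 1"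
    and \<sigma>: "\<sigma> > 0" and l: "l \<ge> 0" and Z: "varU Z > 0"
    and slack: "\<epsilon> = \<infinity> \<and> l = 0 \<or> (\<exists>e. \<epsilon> = ereal e \<and>
       cov_bound F \<mu> \<sigma> e \<le> covU (quantile F) (rescale \<mu> \<sigma> Z) \<and>
       (l = 0 \<or> covU (quantile F) (rescale \<mu> \<sigma> Z) = cov_bound F \<mu> \<sigma> e))"
  shows "\<exists>G. is_maximiser g F \<epsilon> \<mu> \<sigma> G"
    and "is_maximiser g F \<epsilon> \<mu> \<sigma> G \<Longrightarrow> AE u in unif. quantile G u = rescale \<mu> \<sigma> Z u"
    and "supH g F \<epsilon> \<mu> \<sigma> = Hq g (rescale \<mu> \<sigma> Z)"
    and "Hq g (rescale \<mu> \<sigma> Z) = \<mu> + \<sigma> / stdU Z * covU (gam g) Z"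
proof -
  let ?Q = "quantile F" and ?h = "rescale \<mu> \<sigma> Z"
  note Q = quantile_L2U[OF F(1)] quantile_mono[OF F(1)]
  have ZL: "Z \<in> L2U" unfolding Z_def by (intro L2U_add L2U_cmult \<gamma> Q)
  have Zmono: "mono_on {0<..<1} Z"
    unfolding Z_def using l
    by (auto intro!: mono_onI add_mono mult_left_mono mono_onD[OF \<gamma>(2)] mono_onD[OF Q(2)])
  note h = rescale_L2U[OF ZL Z, of \<mu> \<sigma>] EU_rescale[OF ZL Z, of \<mu> \<sigma>] varU_rescale[OF ZL Z, of \<mu> \<sigma>]
  have b: "stdU Z > 0" using Z by (simp add: stdU_def)
  \<comment> \<open>The normalisation \<open>EU (gam g) = 1\<close> makes the objective the mean
    plus a covariance.\<close>
  have Hq: "Hq g q = \<mu> + covU (gam g) q" if "EU q = \<mu>" for q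
    using that \<gamma>(3) by (simp add: Hq_def covU_def)
  show "Hq g ?h = \<mu> + \<sigma> / stdU Z * covU (gam g) Z"
    using covU_rescale[OF ZL Z \<gamma>(1)] Hq[OF h(2)] by simp
  have lag: "covU (gam g) q = covU Z q - l * covU ?Q q" if "q \<in> L2U" for q
    using that unfolding Z_def by (simp add: covU_add_left covU_cmult_left L2U_cmult \<gamma> Q)
  have Zh: "covU Z ?h = \<sigma> * stdU Z"
    using covU_eq_deficit[OF ZL Z h \<sigma>] by (simp add: EU_const)
  have bound: "H g G \<le> Hq g ?h - stdU Z / (2 * \<sigma>) * EU (\<lambda>u. (quantile G u - ?h u)\<^sup>2)"
    if G: "G \<in> Meps F \<epsilon> \<mu> \<sigma>" for G
  proof -
    have GM: "G \<in> M2" using G by (simp add: Meps_def)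
    note q = quantile_L2U[OF GM]
    note G' = G[unfolded mem_Meps_iff[OF F GM]]
    \<comment> \<open>For \<open>l \<noteq> 0\<close>, \<open>slack\<close> leaves a finite
      \<open>\<epsilon>\<close> and makes the constraint bind at \<open>?h\<close>, whereas
      \<open>G\<close> satisfies it as an inequality.\<close>
    have "l * covU ?Q ?h \<le> l * covU ?Q (quantile G)"
    proof (cases "l = 0")
      case False
      then show ?thesis using slack G' l by (auto intro!: mult_left_mono)
    qed simp
    moreover have "covU Z (quantile G)
        = \<sigma> * stdU Z - stdU Z / (2 * \<sigma>) * EU (\<lambda>u. (quantile G u - ?h u)\<^sup>2)"
      by (rule covU_eq_deficit[OF ZL Z q _ _ \<sigma>]) (use G' in auto)
    moreover have "H g G = \<mu> + (covU Z (quantile G) - l * covU ?Q (quantile G))"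
      using Hq[of "quantile G"] lag[OF q] G' by (simp add: H_def)
    moreover have "Hq g ?h = \<mu> + (\<sigma> * stdU Z - l * covU ?Q ?h)"
      using Hq[OF h(2)] lag[OF h(1)] Zh by simp
    ultimately show ?thesis by linarith
  qed
  have defnn: "0 \<le> stdU Z / (2 * \<sigma>) * EU (\<lambda>u. (q u - ?h u)\<^sup>2)" for q
    using b \<sigma> by (simp add: EU_eq)
  have le: "H g G \<le> Hq g ?h" if "G \<in> Meps F \<epsilon> \<mu> \<sigma>" for G
    using bound[OF that] defnn[of "quantile G"] by linarith
  \<comment> \<open>As \<open>l\<close> is nonnegative, \<open>Z\<close> and \<open>?h\<close> are
    nondecreasing, so the law of \<open>?h\<close> has \<open>?h\<close> as its quantile function
    almost everywhere; this law attains the bound.\<close>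
  define G0 where "G0 = distr unif borel ?h"
  note hmono = rescale_mono[OF Zmono \<sigma> Z, of \<mu>]
  have G0: "G0 \<in> M2" and ae: "AE u in unif. quantile G0 u = ?h u"
    using quantile_distr_mono[OF h(1) hmono] by (auto simp: G0_def)
  note q0 = quantile_L2U[OF G0]
  have cov0: "covU f (quantile G0) = covU f ?h" if "f \<in> L2U" for f
    using covU_cong_AE[OF ae q0 h(1) that] by (simp add: covU_commute[of f])
  have E0: "EU (quantile G0) = \<mu>"
    using EU_cong_AE[OF ae L2U_measurable[OF q0] L2U_measurable[OF h(1)]] h(2) by simp
  have "varU (quantile G0) = \<sigma>\<^sup>2"
    using cov0[OF q0] cov0[OF h(1)] h(3) by (simp add: varU_def covU_commute)
  then have mem: "G0 \<in> Meps F \<epsilon> \<mu> \<sigma>"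
    unfolding mem_Meps_iff[OF F G0] cov0[OF Q(1)] using E0 slack by auto
  have H0: "H g G0 = Hq g ?h"
    using Hq[OF E0] Hq[OF h(2)] cov0[OF \<gamma>(1)] by (simp add: H_def)
  have max0: "is_maximiser g F \<epsilon> \<mu> \<sigma> G0"
    using mem le H0 by (simp add: is_maximiser_def)
  then show "\<exists>G. is_maximiser g F \<epsilon> \<mu> \<sigma> G" ..
  show "supH g F \<epsilon> \<mu> \<sigma> = Hq g ?h"
    unfolding supH_def by (rule cSup_eq_maximum) (use mem H0 le in \<open>auto simp flip: H0\<close>)
  show "AE u in unif. quantile G u = ?h u" if G: "is_maximiser g F \<epsilon> \<mu> \<sigma> G"
  proof -
    have GM: "G \<in> Meps F \<epsilon> \<mu> \<sigma>" using G by (simp add: is_maximiser_def)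
    then have "G \<in> M2" by (simp add: Meps_def)
    \<comment> \<open>\<open>G\<close> does at least as well as \<open>G0\<close>, which leaves no
      room for the deficit in \<open>bound\<close>.\<close>
    have "Hq g ?h \<le> H g G" using G mem H0 by (auto simp: is_maximiser_def)
    then have "stdU Z / (2 * \<sigma>) * EU (\<lambda>u. (quantile G u - ?h u)\<^sup>2) = 0"
      using bound[OF GM] defnn[of "quantile G"] by linarith
    then have "EU (\<lambda>u. (quantile G u - ?h u)\<^sup>2) = 0" using b \<sigma> by simp
    then show ?thesis
      using EU_diff_squared_eq_0_iff[OF quantile_L2U[OF \<open>G \<in> M2\<close>] h(1)] by simp
  qed
qed

text \<open>With \<open>t = C + l * s\<^sup>2\<close> the variance \<open>V + 2 * l * C + l\<^sup>2 * s\<^sup>2\<close> of \<open>\<gamma> + l * F\<^sup>-\<^sup>1\<close> becomes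
  \<open>(t\<^sup>2 + (V * s\<^sup>2 - C\<^sup>2)) / s\<^sup>2\<close>, so the binding constraint is a pure quadratic equation in \<open>t\<close>.\<close>

lemma multiplier_equation:
  fixes C V K s \<sigma> :: real
  defines "l \<equiv> K / s\<^sup>2 * sqrt ((C\<^sup>2 - V * s\<^sup>2) / (K\<^sup>2 - \<sigma>\<^sup>2 * s\<^sup>2)) - C / s\<^sup>2"
  assumes C: "0 \<le> C" "C\<^sup>2 < V * s\<^sup>2" and V: "0 < V" and s: "0 < s" and \<sigma>: "0 < \<sigma>"
    and K: "0 < K" "K < \<sigma> * s" "C\<^sup>2 * \<sigma>\<^sup>2 < K\<^sup>2 * V"
  shows "0 < l"
    and "0 < l' \<Longrightarrow> \<sigma> / sqrt (V + 2 * l' * C + l'\<^sup>2 * s\<^sup>2) * (C + l' * s\<^sup>2) = K \<longleftrightarrow> l' = l"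
proof -
  \<comment> \<open>Numerator and denominator are both negative, so the root is taken of a positive
    number.\<close>
  define r where "r = (C\<^sup>2 - V * s\<^sup>2) / (K\<^sup>2 - \<sigma>\<^sup>2 * s\<^sup>2)"
  have K2: "K\<^sup>2 < \<sigma>\<^sup>2 * s\<^sup>2"
    using K power_strict_mono[of K "\<sigma> * s" 2] by (simp add: power_mult_distrib)
  have r: "r > 0" "r * (\<sigma>\<^sup>2 * s\<^sup>2 - K\<^sup>2) = V * s\<^sup>2 - C\<^sup>2"
    using K2 C by (auto simp: r_def divide_neg_neg field_simps)
  define t where "t = K * sqrt r"
  have t: "t > 0" "t\<^sup>2 = K\<^sup>2 * r" using r K by (auto simp: t_def power_mult_distrib)
  have l_eq: "C + l * s\<^sup>2 = t" using s by (simp add: l_def t_def r_def field_simps)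
  \<comment> \<open>\<open>K(3)\<close> says that at multiplier 0 the covariance is below
    \<open>K\<close>; in terms of \<open>t\<close> this becomes \<open>C < t\<close>, whence
    \<open>l\<close> is positive.\<close>
  have "C\<^sup>2 * (\<sigma>\<^sup>2 * s\<^sup>2) < K\<^sup>2 * (V * s\<^sup>2)"
    using mult_strict_right_mono[OF K(3), of "s\<^sup>2"] s by (simp add: mult.assoc)
  then have "C\<^sup>2 * (\<sigma>\<^sup>2 * s\<^sup>2 - K\<^sup>2) < K\<^sup>2 * (V * s\<^sup>2 - C\<^sup>2)" by (simp add: algebra_simps)
  also have "\<dots> = t\<^sup>2 * (\<sigma>\<^sup>2 * s\<^sup>2 - K\<^sup>2)" using t(2) r(2) by (simp add: mult.assoc)
  finally have "C\<^sup>2 < t\<^sup>2" using K2 by simp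
  then have "C < t" using t(1) by (simp add: power_less_imp_less_base)
  then show "0 < l" using l_eq s by (smt (verit) mult_nonpos_nonneg zero_le_power2)
  show "\<sigma> / sqrt (V + 2 * l' * C + l'\<^sup>2 * s\<^sup>2) * (C + l' * s\<^sup>2) = K \<longleftrightarrow> l' = l" if l': "0 < l'"
  proof -
    define B where "B = V + 2 * l' * C + l'\<^sup>2 * s\<^sup>2"
    define t' where "t' = C + l' * s\<^sup>2"
    have B: "B > 0" unfolding B_def using V l' C by (auto intro!: add_pos_nonneg)
    have t': "t' > 0" unfolding t'_def using C l' s by (auto intro!: add_nonneg_pos)
    have Bs: "B * s\<^sup>2 = t'\<^sup>2 + (V * s\<^sup>2 - C\<^sup>2)"
      by (simp add: B_def t'_def power2_eq_square algebra_simps)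
    \<comment> \<open>Both sides are positive, so squaring is reversible; the factor
      \<open>s\<^sup>2\<close> then lets \<open>Bs\<close> eliminate \<open>B\<close>.\<close>
    have "\<sigma> / sqrt B * t' = K \<longleftrightarrow> \<sigma> * t' = K * sqrt B" using B by (simp add: field_simps)
    also have "\<dots> \<longleftrightarrow> (\<sigma> * t')\<^sup>2 = (K * sqrt B)\<^sup>2"
      using \<sigma> t' K B by (intro power2_eq_iff_nonneg[symmetric]) auto
    also have "\<dots> \<longleftrightarrow> \<sigma>\<^sup>2 * t'\<^sup>2 * s\<^sup>2 = K\<^sup>2 * B * s\<^sup>2" using B s by (simp add: power_mult_distrib)
    also have "\<dots> \<longleftrightarrow> t'\<^sup>2 * (\<sigma>\<^sup>2 * s\<^sup>2 - K\<^sup>2) = K\<^sup>2 * (V * s\<^sup>2 - C\<^sup>2)"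
      unfolding mult.assoc Bs by (simp add: algebra_simps)
    also have "\<dots> \<longleftrightarrow> t'\<^sup>2 * (\<sigma>\<^sup>2 * s\<^sup>2 - K\<^sup>2) = t\<^sup>2 * (\<sigma>\<^sup>2 * s\<^sup>2 - K\<^sup>2)"
      unfolding t(2) r(2)[symmetric] by (simp add: mult.assoc)
    also have "\<dots> \<longleftrightarrow> t' = t" using K2 t(1) t' by simp
    also have "\<dots> \<longleftrightarrow> l' = l" using s by (simp add: t'_def flip: l_eq)
    finally show ?thesis by (simp add: B_def t'_def)
  qed
qed

section \<open>The regimes of positive and of zero multiplier\<close>

theorem theorem1:
  fixes F :: "real measure" and g :: "real \<Rightarrow> real" and \<mu> \<sigma> :: real
  defines "\<gamma> \<equiv> gam g"
    and "\<mu>F \<equiv> meanD F" and "\<sigma>F \<equiv> stdD F"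
    and "c0 \<equiv> corrU (quantile F) (gam g)"
    and "V \<equiv> varU (gam g)"
    and "C \<equiv> covU (quantile F) (gam g)"
    and "K \<equiv> (\<lambda>\<epsilon>::real. ((meanD F)\<^sup>2 + (stdD F)\<^sup>2 + \<mu>\<^sup>2 + \<sigma>\<^sup>2 - 2 * \<mu> * meanD F - \<epsilon>) / 2)"
    and "lo \<equiv> (meanD F - \<mu>)\<^sup>2 + (stdD F - \<sigma>)\<^sup>2"
    and "h \<equiv> hlam g F \<mu> \<sigma>"
  assumes F: "F \<in> M2" and \<sigma>F_pos: "stdD F > 0"
    and g_dist: "distortion g" and g_concave: "concave_on {0..1} g"
    and A1: "abs_cont_on {0..1} g" "set_integrable lborel {0<..<1} (\<lambda>u. (gam g u)\<^sup>2)"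
    and A2: "\<not> (AE u in lborel. u \<in> {0<..<1} \<longrightarrow> gam g u = 1)"
    and \<sigma>_pos: "\<sigma> > 0"
  shows
    "(c0 < 1 \<longrightarrow>
       (\<forall>\<epsilon>::real. lo < \<epsilon> \<and> \<epsilon> < lo + 2 * \<sigma> * \<sigma>F * (1 - c0) \<longrightarrow>
          (let l = K \<epsilon> / \<sigma>F\<^sup>2 * sqrt ((C\<^sup>2 - V * \<sigma>F\<^sup>2) / ((K \<epsilon>)\<^sup>2 - \<sigma>\<^sup>2 * \<sigma>F\<^sup>2)) - C / \<sigma>F\<^sup>2
           in K \<epsilon> \<ge> 0 \<and>
              l > 0 \<and> dWq (quantile F) (h l) = sqrt \<epsilon> \<and>
              (\<forall>l'>0. dWq (quantile F) (h l') = sqrt \<epsilon> \<longrightarrow> l' = l) \<and>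
              (\<exists>G. is_maximiser g F (ereal \<epsilon>) \<mu> \<sigma> G) \<and>
              (\<forall>G. is_maximiser g F (ereal \<epsilon>) \<mu> \<sigma> G \<longrightarrow>
                    (AE u in lborel. u \<in> {0<..<1} \<longrightarrow> quantile G u = h l u)) \<and>
              supH g F (ereal \<epsilon>) \<mu> \<sigma> = Hq g (h l) \<and>
              Hq g (h l) = \<mu> + \<sigma> / stdU (\<lambda>u. \<gamma> u + l * quantile F u) * (V + l * C) \<and>
              Hq g (h l) = \<mu> + \<sigma> * stdU \<gamma> * corrU \<gamma> (\<lambda>u. \<gamma> u + l * quantile F u))) \<and>
       continuous_on {lo<..<lo + 2 * \<sigma> * \<sigma>F * (1 - c0)} (\<lambda>\<epsilon>. supH g F (ereal \<epsilon>) \<mu> \<sigma>))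
   \<and>
    (\<forall>\<epsilon>::ereal. ereal lo < \<epsilon> \<and> ereal (lo + 2 * \<sigma> * \<sigma>F * (1 - c0)) \<le> \<epsilon> \<longrightarrow>
       (\<exists>G. is_maximiser g F \<epsilon> \<mu> \<sigma> G) \<and>
       (\<forall>G. is_maximiser g F \<epsilon> \<mu> \<sigma> G \<longrightarrow>
             (AE u in lborel. u \<in> {0<..<1} \<longrightarrow> quantile G u = h 0 u)) \<and>
       supH g F \<epsilon> \<mu> \<sigma> = \<mu> + \<sigma> * stdU \<gamma>)"
proof -
  define Z where "Z l = (\<lambda>u. gam g u + l * quantile F u)" for l
  have h_def': "h l = rescale \<mu> \<sigma> (Z l)" for l
    by (simp add: h_def hlam_eq_rescale Z_def)
  have K_def': "K \<epsilon> = cov_bound F \<mu> \<sigma> \<epsilon>" for \<epsilon> by (simp add: K_def cov_bound_def)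
  note FF = F \<sigma>F_pos
  note Q = quantile_L2U[OF F] quantile_mono[OF F]
  note \<gamma> = gam_L2U[OF g_concave A1(2)] gam_mono[OF g_concave]
  have E\<gamma>: "EU (gam g) = 1"
    using EU_gam[OF g_concave abs_cont_on_imp_continuous_on[OF A1(1)] \<gamma>(1)] g_dist
    by (simp add: distortion_def)
  have sF: "\<sigma>F > 0" "varU (quantile F) = \<sigma>F\<^sup>2" "stdU (quantile F) = \<sigma>F"
    using varU_quantile_eq_stdD[OF FF] \<sigma>F_pos by (auto simp: \<sigma>F_def stdU_def)
  have V: "V > 0"
  proof -
    \<comment> \<open>\<open>V\<close> is the squared distance from \<open>gam g\<close> to its mean
      1, which \<open>A2\<close> keeps from vanishing.\<close>
    have "EU (\<lambda>u. (gam g u - 1)\<^sup>2) = V"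
      using EU_diff_squared[OF \<gamma>(1) L2U_const[of 1]] E\<gamma>
      by (simp add: EU_const varU_def covU_const_left covU_commute[of "gam g" "\<lambda>_. 1"] V_def)
    moreover have "EU (\<lambda>u. (gam g u - 1)\<^sup>2) \<noteq> 0"
      using EU_diff_squared_eq_0_iff[OF \<gamma>(1) L2U_const[of 1]] A2 by (simp add: AE_unif)
    moreover have "EU (\<lambda>u. (gam g u - 1)\<^sup>2) \<ge> 0" by (simp add: EU_eq)
    ultimately show ?thesis by linarith
  qed
  have C0: "C \<ge> 0" unfolding C_def by (rule covU_mono_nonneg[OF Q \<gamma>])
  have c0: "c0 = C / (\<sigma>F * sqrt V)"
    unfolding c0_def corrU_def sF(3) by (simp add: C_def V_def stdU_def)
  have ZL: "Z l \<in> L2U" for l unfolding Z_def by (intro L2U_add L2U_cmult \<gamma> Q)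
  have cov\<gamma>Z: "covU (gam g) (Z l) = V + l * C" for l
    unfolding Z_def covU_commute[of "gam g"]
    by (simp add: covU_add_left covU_cmult_left L2U_cmult \<gamma> Q V_def C_def varU_def)
  have covQZ: "covU (quantile F) (Z l) = C + l * \<sigma>F\<^sup>2" for l
    unfolding Z_def covU_commute[of "quantile F"] using sF(2)
    by (simp add: covU_add_left covU_cmult_left L2U_cmult \<gamma> Q C_def varU_def
        covU_commute[of "gam g" "quantile F"])
  have varZ: "varU (Z l) = V + 2 * l * C + l\<^sup>2 * \<sigma>F\<^sup>2" for l
  proof -
    have "varU (Z l) = covU (gam g) (Z l) + l * covU (quantile F) (Z l)"
      unfolding varU_def by (subst (1) Z_def) (simp add: covU_add_left covU_cmult_left L2U_cmult \<gamma> Q ZL)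
    then show ?thesis unfolding cov\<gamma>Z covQZ by (simp add: power2_eq_square algebra_simps)
  qed
  have varZ_pos: "varU (Z l) > 0" if "l \<ge> 0" for l
    unfolding varZ using V C0 that by (auto intro!: add_pos_nonneg)
  have stdZ: "stdU (Z l) = sqrt (V + 2 * l * C + l\<^sup>2 * \<sigma>F\<^sup>2)" for l
    by (simp add: stdU_def varZ)
  have covQh: "covU (quantile F) (h l)
      = \<sigma> / sqrt (V + 2 * l * C + l\<^sup>2 * \<sigma>F\<^sup>2) * (C + l * \<sigma>F\<^sup>2)" if "l \<ge> 0" for l
    unfolding h_def' using covU_rescale[OF ZL varZ_pos[OF that] Q(1)] covQZ stdZ by simp
  have dWq_iff: "dWq (quantile F) (h l) = sqrt \<epsilon> \<longleftrightarrow> covU (quantile F) (h l) = K \<epsilon>"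
    if "l \<ge> 0" for l \<epsilon>
    using EU_diff_quantile_squared[OF FF rescale_L2U EU_rescale varU_rescale,
        OF ZL varZ_pos[OF that] ZL varZ_pos[OF that] ZL varZ_pos[OF that], of \<mu> \<sigma> \<epsilon>]
    unfolding dWq_def h_def' K_def' by auto
  note opt = maximiser_rescale[where \<mu> = \<mu>, OF FF \<gamma> E\<gamma> \<sigma>_pos, folded Z_def, OF _ varZ_pos, folded h_def' K_def']
  \<comment> \<open>Since \<open>2 * K \<epsilon> = lo + 2 * \<sigma> * \<sigma>F -
    \<epsilon>\<close>, bounds on \<open>\<epsilon>\<close> become bounds on
    \<open>K \<epsilon>\<close>: the upper one is the Cauchy-Schwarz limit, the lower one the
    covariance of \<open>quantile F\<close> with \<open>h 0\<close>.\<close>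
  have K_lo: "lo < \<epsilon> \<longleftrightarrow> K \<epsilon> < \<sigma> * \<sigma>F" for \<epsilon>
    by (simp add: K_def lo_def \<sigma>F_def power2_diff field_simps)
  have K_hi: "\<epsilon> < lo + 2 * \<sigma> * \<sigma>F * (1 - c0) \<longleftrightarrow> \<sigma> * \<sigma>F * c0 < K \<epsilon>" for \<epsilon>
    by (simp add: K_def lo_def \<sigma>F_def power2_diff field_simps)
  have Sc0: "\<sigma> * \<sigma>F * c0 = \<sigma> / sqrt V * C" using sF(1) V by (simp add: c0 field_simps)

  define L where
    "L \<epsilon> = K \<epsilon> / \<sigma>F\<^sup>2 * sqrt ((C\<^sup>2 - V * \<sigma>F\<^sup>2) / ((K \<epsilon>)\<^sup>2 - \<sigma>\<^sup>2 * \<sigma>F\<^sup>2)) - C / \<sigma>F\<^sup>2" for \<epsilon>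
  have part1: "K \<epsilon> \<ge> 0 \<and> L \<epsilon> > 0 \<and> dWq (quantile F) (h (L \<epsilon>)) = sqrt \<epsilon> \<and>
      (\<forall>l'>0. dWq (quantile F) (h l') = sqrt \<epsilon> \<longrightarrow> l' = L \<epsilon>) \<and>
      (\<exists>G. is_maximiser g F (ereal \<epsilon>) \<mu> \<sigma> G) \<and>
      (\<forall>G. is_maximiser g F (ereal \<epsilon>) \<mu> \<sigma> G \<longrightarrow>
            (AE u in lborel. u \<in> {0<..<1} \<longrightarrow> quantile G u = h (L \<epsilon>) u)) \<and>
      supH g F (ereal \<epsilon>) \<mu> \<sigma> = Hq g (h (L \<epsilon>)) \<and>
      Hq g (h (L \<epsilon>)) = \<mu> + \<sigma> / stdU (Z (L \<epsilon>)) * (V + L \<epsilon> * C) \<and>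
      Hq g (h (L \<epsilon>)) = \<mu> + \<sigma> * stdU \<gamma> * corrU \<gamma> (Z (L \<epsilon>))"
    if "c0 < 1" and \<epsilon>: "lo < \<epsilon>" "\<epsilon> < lo + 2 * \<sigma> * \<sigma>F * (1 - c0)" for \<epsilon>
  proof -
    \<comment> \<open>The covariance of \<open>h 0\<close> with \<open>quantile F\<close> falls
      short of \<open>K \<epsilon>\<close>: the unconstrained optimum is infeasible.\<close>
    have Klo: "\<sigma> / sqrt V * C < K \<epsilon>" using \<epsilon>(2) K_hi Sc0 by simp
    moreover have "0 \<le> \<sigma> / sqrt V * C" using \<sigma>_pos V C0 by simp
    ultimately have Kpos: "0 < K \<epsilon>" by linarith
    \<comment> \<open>\<open>c0 < 1\<close> is strict Cauchy-Schwarz for \<open>quantile F\<close>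
      and \<open>gam g\<close>, which keeps the numerator under the root in \<open>L\<close> from
      vanishing.\<close>
    have "C < \<sigma>F * sqrt V" using \<open>c0 < 1\<close> sF(1) V by (simp add: c0 field_simps)
    then have CV: "C\<^sup>2 < V * \<sigma>F\<^sup>2"
      using power_strict_mono[of C "\<sigma>F * sqrt V" 2] C0 V by (simp add: power_mult_distrib mult.commute)
    have "C * \<sigma> < K \<epsilon> * sqrt V" using Klo V by (simp add: field_simps)
    then have KV: "C\<^sup>2 * \<sigma>\<^sup>2 < (K \<epsilon>)\<^sup>2 * V"
      using power_strict_mono[of "C * \<sigma>" "K \<epsilon> * sqrt V" 2] C0 \<sigma>_pos V
      by (simp add: power_mult_distrib)
    note mult = multiplier_equation[OF C0 CV V sF(1) \<sigma>_pos Kpos _ KV, folded L_def]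
    have Kup: "K \<epsilon> < \<sigma> * \<sigma>F" using \<epsilon>(1) K_lo by simp
    have L: "L \<epsilon> > 0" using mult(1)[OF Kup] .
    have cov_iff: "covU (quantile F) (h l') = K \<epsilon> \<longleftrightarrow> l' = L \<epsilon>" if "l' > 0" for l'
      using mult(2)[OF Kup that] covQh[of l'] that by simp
    have cov: "covU (quantile F) (h (L \<epsilon>)) = K \<epsilon>" using cov_iff[OF L] by simp
    have slack: "ereal \<epsilon> = \<infinity> \<and> L \<epsilon> = 0 \<or> (\<exists>e. ereal \<epsilon> = ereal e \<and>
       K e \<le> covU (quantile F) (h (L \<epsilon>)) \<and> (L \<epsilon> = 0 \<or> covU (quantile F) (h (L \<epsilon>)) = K e))"
      using cov by auto
    note o = opt[OF less_imp_le[OF L] less_imp_le[OF L] slack]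
    have std\<gamma>: "stdU \<gamma> > 0" using V by (simp add: \<gamma>_def stdU_def V_def)
    have "Hq g (h (L \<epsilon>)) = \<mu> + \<sigma> / stdU (Z (L \<epsilon>)) * (V + L \<epsilon> * C)"
      using o(4) unfolding cov\<gamma>Z .
    moreover have "\<sigma> * stdU \<gamma> * corrU \<gamma> (Z (L \<epsilon>)) = \<sigma> / stdU (Z (L \<epsilon>)) * (V + L \<epsilon> * C)"
      using std\<gamma> cov\<gamma>Z[of "L \<epsilon>"] by (simp add: corrU_def \<gamma>_def)
    ultimately show ?thesis
      using Kpos L cov o(1,2,3) cov_iff dWq_iff by (simp add: AE_unif)
  qed
  have part1_cont: "continuous_on {lo<..<lo + 2 * \<sigma> * \<sigma>F * (1 - c0)} (\<lambda>\<epsilon>. supH g F (ereal \<epsilon>) \<mu> \<sigma>)"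
    if "c0 < 1"
  proof -
    let ?I = "{lo<..<lo + 2 * \<sigma> * \<sigma>F * (1 - c0)}"
    have p1: "0 \<le> K \<epsilon>" "L \<epsilon> > 0" "supH g F (ereal \<epsilon>) \<mu> \<sigma> = \<mu> + \<sigma> / stdU (Z (L \<epsilon>)) * (V + L \<epsilon> * C)"
      if "\<epsilon> \<in> ?I" for \<epsilon>
    proof -
      note p = part1[OF \<open>c0 < 1\<close> greaterThanLessThan_iff[THEN iffD1, THEN conjunct1, OF that]
          greaterThanLessThan_iff[THEN iffD1, THEN conjunct2, OF that]]
      show "0 \<le> K \<epsilon>" "L \<epsilon> > 0" using p by blast+
      show "supH g F (ereal \<epsilon>) \<mu> \<sigma> = \<mu> + \<sigma> / stdU (Z (L \<epsilon>)) * (V + L \<epsilon> * C)"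
        using p by presburger
    qed
    \<comment> \<open>Division by zero has the value 0, so continuity of the closed form rests on
      nonvanishing denominators in \<open>L\<close> and in the optimal value.\<close>
    have ne: "(K \<epsilon>)\<^sup>2 - \<sigma>\<^sup>2 * \<sigma>F\<^sup>2 \<noteq> 0" if "\<epsilon> \<in> ?I" for \<epsilon>
    proof -
      have "K \<epsilon> < \<sigma> * \<sigma>F" "0 \<le> K \<epsilon>"
        using that K_lo[of \<epsilon>] p1(1)[OF that] by auto
      then have "(K \<epsilon>)\<^sup>2 < (\<sigma> * \<sigma>F)\<^sup>2" by (intro power_strict_mono) auto
      then show ?thesis by (simp add: power_mult_distrib)
    qed
    have ne': "sqrt (V + 2 * L \<epsilon> * C + (L \<epsilon>)\<^sup>2 * \<sigma>F\<^sup>2) \<noteq> 0" if "\<epsilon> \<in> ?I" for \<epsilon>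
      using varZ_pos[of "L \<epsilon>"] p1(2)[OF that] varZ[of "L \<epsilon>"] by simp
    have "continuous_on ?I L"
      unfolding L_def[abs_def] K_def using ne[unfolded K_def] sF(1) by (intro continuous_intros) auto
    then have "continuous_on ?I
        (\<lambda>\<epsilon>. \<mu> + \<sigma> / sqrt (V + 2 * L \<epsilon> * C + (L \<epsilon>)\<^sup>2 * \<sigma>F\<^sup>2) * (V + L \<epsilon> * C))"
      using ne' by (intro continuous_intros) auto
    then show ?thesis
      by (rule continuous_on_eq) (simp add: p1(3) stdZ)
  qed
  have part2: "(\<exists>G. is_maximiser g F \<epsilon> \<mu> \<sigma> G) \<and>
      (\<forall>G. is_maximiser g F \<epsilon> \<mu> \<sigma> G \<longrightarrow>
            (AE u in lborel. u \<in> {0<..<1} \<longrightarrow> quantile G u = h 0 u)) \<and>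
      supH g F \<epsilon> \<mu> \<sigma> = \<mu> + \<sigma> * stdU \<gamma>"
    if \<epsilon>: "ereal lo < \<epsilon>" "ereal (lo + 2 * \<sigma> * \<sigma>F * (1 - c0)) \<le> \<epsilon>" for \<epsilon>
  proof -
    have cov: "covU (quantile F) (h 0) = \<sigma> * \<sigma>F * c0" using covQh[of 0] Sc0 by simp
    \<comment> \<open>At multiplier 0 only the feasibility of \<open>h 0\<close> is at stake; for
      finite \<open>\<epsilon>\<close> it follows from the lower bound on \<open>\<epsilon>\<close>
      through \<open>K_hi\<close>.\<close>
    have slack: "\<epsilon> = \<infinity> \<and> (0::real) = 0 \<or> (\<exists>e. \<epsilon> = ereal e \<and>
       K e \<le> covU (quantile F) (h 0) \<and> ((0::real) = 0 \<or> covU (quantile F) (h 0) = K e))"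
    proof (cases \<epsilon>)
      case (real e)
      then show ?thesis using \<epsilon>(2) K_hi[of e] unfolding cov by auto
    qed (use \<epsilon> in auto)
    note o = opt[OF order_refl order_refl slack]
    have "\<sigma> / stdU (Z 0) * V = \<sigma> * stdU \<gamma>"
      using V real_div_sqrt[of V]
      by (simp add: stdZ \<gamma>_def stdU_def[of "gam g"] flip: V_def times_divide_eq_right)
    then have "Hq g (h 0) = \<mu> + \<sigma> * stdU \<gamma>"
      using o(4) cov\<gamma>Z[of 0] by simp
    then show ?thesis using o(1,2,3) by (simp add: AE_unif)
  qed
  show ?thesis
    \<comment> \<open>Unfolding \<open>\<gamma>\<close> exposes the sums that fold to
      \<open>Z\<close>; the remaining occurrences of \<open>gam g\<close> are then folded
      back.\<close>
    unfolding Let_def L_def[symmetric]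
    unfolding \<gamma>_def unfolding Z_def[symmetric] unfolding \<gamma>_def[symmetric]
    by (rule conjI, rule impI, rule conjI, intro allI impI, elim conjE, rule part1, assumption+,
        rule part1_cont, assumption, intro allI impI, elim conjE, rule part2)
qed

end
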